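(* Let $f:\mathbb{R}^n\to\mathbb{R}$, $x^0\in\mathbb{R}^n$, $S=[s^1\cdots s^p]\in\mathbb{R}^{n\times p}$, and $Y=\{x^0\}\cup\{x^0+s^i:i=1,\ldots,p\}$. Suppose that $Y$ lies in the $d$-dimensional affine space $\mathcal{Y}=\{x^0+Q\widehat{x}:\widehat{x}\in\mathbb{R}^d\}$, where $d<n$ and $Q\in\mathbb{R}^{n\times d}$ has $d$ orthonormal columns, and let $\widehat{f}(\widehat{x})=f(x^0+Q\widehat{x})$ for $\widehat{x}\in\mathbb{R}^d$. Then there exists $\widehat{S}=[\widehat{s}^1\cdots\widehat{s}^p]\in\mathbb{R}^{d\times p}$ such that $S=Q\widehat{S}$, and the generalized simplex gradient of $f$ at $x^0$ over $S$ and the generalized simplex gradient of $\widehat{f}$ at $0$ over $\widehat{S}$ satisfy $$\nabla_sf(x^0;S)=Q\nabla_s\widehat{f}(0;\widehat{S}).$$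
   Context: $A^\dagger$ denotes the Moore–Penrose pseudoinverse of a matrix $A$. Generalized simplex gradient (GSG). For $g:\mathbb{R}^k\to\mathbb{R}$, $z^0\in\mathbb{R}^k$ and a matrix $A=[a^1\cdots a^p]\in\mathbb{R}^{k\times p}$, the GSG of $g$ at $z^0$ over $A$ is $$\nabla_sg(z^0;A)=(A^\top)^\dagger\,\delta_g(z^0;A)\in\mathbb{R}^k,\qquad \delta_g(z^0;A)=\begin{bmatrix}g(z^0+a^1)-g(z^0)\\ \vdots\\ g(z^0+a^p)-g(z^0)\end{bmatrix}\in\mathbb{R}^p.$$ *)

theory Defs
  imports Complex_Main "Jordan_Normal_Form.Matrix"
begin

text \<open>The four Penrose conditions; over the reals the conjugate transpose is the transpose.\<close>

definition penrose_inverse :: "real mat \<Rightarrow> real mat \<Rightarrow> bool" where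
  "penrose_inverse A X \<longleftrightarrow>
     X \<in> carrier_mat (dim_col A) (dim_row A) \<and>
     A * X * A = A \<and>
     X * A * X = X \<and>
     transpose_mat (A * X) = A * X \<and>
     transpose_mat (X * A) = X * A"

definition pinv :: "real mat \<Rightarrow> real mat" where
  "pinv A = (THE X. penrose_inverse A X)"

text \<open>A function on \<open>k\<close>-dimensional space is represented by a function on vectors of all
  dimensions. If \<open>z\<close> and the columns of \<open>A\<close> have dimension \<open>k\<close>, then only its values on
  vectors of dimension \<open>k\<close> are used below.\<close>

definition gsg_delta :: "(real vec \<Rightarrow> real) \<Rightarrow> real vec \<Rightarrow> real mat \<Rightarrow> real vec" where
  "gsg_delta g z A = vec (dim_col A) (\<lambda>i. g (z + col A i) - g z)"

definition gsg :: "(real vec \<Rightarrow> real) \<Rightarrow> real vec \<Rightarrow> real mat \<Rightarrow> real vec" where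
  "gsg g z A = pinv (transpose_mat A) *\<^sub>v gsg_delta g z A"

definition orthonormal_cols :: "real mat \<Rightarrow> bool" where
  "orthonormal_cols Q \<longleftrightarrow>
     (\<forall>i < dim_col Q. \<forall>j < dim_col Q. col Q i \<bullet> col Q j = (if i = j then 1 else 0))"

end

(* The normal equations of least squares are always solvable; solving them for A and for its
   transpose gives a {1,3}- and a {1,4}-inverse, and these combine to the Moore-Penrose inverse.
   If Q has orthonormal columns, then Q X satisfies the Penrose conditions for B Q^T whenever X
   satisfies them for B, so pinv (B Q^T) = Q pinv B. The theorem is this identity for the
   transpose of Shat = Q^T S, because the two vectors of differences agree. *)
theory Submission
  imports Defs
begin

section \<open>Existence and uniqueness of the Moore--Penrose inverse\<close>

text \<open>One Gram-Schmidt step per vector: \<open>a k\<close> and \<open>b\<close> are both split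
  along the first \<open>k\<close> vectors, and the residual of \<open>b\<close> is then projected
  onto the residual of \<open>a k\<close>. The vectors may be linearly dependent.\<close>

lemma normal_equations_sum:
  fixes a :: "nat \<Rightarrow> nat \<Rightarrow> real"
  shows "\<exists>x. \<forall>j<k. (\<Sum>i<m. a j i * (b i - (\<Sum>l<k. x l * a l i))) = 0"
proof (induction k arbitrary: b)
  case 0
  show ?case by simp
next
  case (Suc k)
  obtain y where y: "\<And>j. j < k \<Longrightarrow> (\<Sum>i<m. a j i * (a k i - (\<Sum>l<k. y l * a l i))) = 0"
    using Suc.IH[of "a k"] by blast
  obtain x where x: "\<And>j. j < k \<Longrightarrow> (\<Sum>i<m. a j i * (b i - (\<Sum>l<k. x l * a l i))) = 0"
    using Suc.IH[of b] by blast
  define r where "r i = a k i - (\<Sum>l<k. y l * a l i)" for i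
  define e where "e i = b i - (\<Sum>l<k. x l * a l i)" for i
  \<comment> \<open>The coefficient of the projection of \<open>e\<close> onto \<open>r\<close>. If
    \<open>r\<close> vanishes on the indices below \<open>m\<close>, division by zero makes
    \<open>t\<close> zero, and both sides of \<open>re\<close> are zero.\<close>
  define t where "t = (\<Sum>i<m. r i * e i) / (\<Sum>i<m. r i * r i)"
  \<comment> \<open>Chosen so that the new residual is \<open>e - t * r\<close>: the vector
    \<open>r\<close> is expanded in \<open>a 0, ..., a k\<close>, where \<open>a k\<close> has
    coefficient 1.\<close>
  define z where "z l = (if l < k then x l - t * y l else t)" for l
  \<comment> \<open>\<open>a k\<close> and \<open>r\<close> differ by a combination of earlier
    vectors, which \<open>g\<close> does not see. This is used for \<open>g = e\<close> and
    \<open>g = r\<close>.\<close>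
  have ak: "(\<Sum>i<m. a k i * g i) = (\<Sum>i<m. r i * g i)"
    if g: "\<And>j. j < k \<Longrightarrow> (\<Sum>i<m. a j i * g i) = 0" for g
  proof -
    have "(\<Sum>i<m. (\<Sum>l<k. y l * a l i) * g i) = (\<Sum>l<k. y l * (\<Sum>i<m. a l i * g i))"
      unfolding sum_distrib_left sum_distrib_right
      by (subst sum.swap) (simp add: mult.assoc)
    also have "\<dots> = 0" using g by simp
    finally show ?thesis by (simp add: r_def left_diff_distrib sum_subtractf)
  qed
  have residual: "b i - (\<Sum>l<Suc k. z l * a l i) = e i - t * r i" for i
  proof -
    have "(\<Sum>l<k. z l * a l i) = (\<Sum>l<k. x l * a l i) - t * (\<Sum>l<k. y l * a l i)"
      by (simp add: z_def sum_distrib_left left_diff_distrib sum_subtractf mult.assoc)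
    then show ?thesis by (simp add: z_def e_def r_def algebra_simps)
  qed
  have re: "(\<Sum>i<m. r i * e i) = t * (\<Sum>i<m. r i * r i)"
  proof (cases "(\<Sum>i<m. r i * r i) = 0")
    case True
    then have "\<forall>i<m. r i = 0" by (simp add: sum_nonneg_eq_0_iff)
    then show ?thesis by simp
  qed (simp add: t_def)
  have "(\<Sum>i<m. a j i * (e i - t * r i)) = 0" if "j < Suc k" for j
  proof -
    have split: "(\<Sum>i<m. a j i * (e i - t * r i))
      = (\<Sum>i<m. a j i * e i) - t * (\<Sum>i<m. a j i * r i)"
      by (simp add: right_diff_distrib sum_subtractf sum_distrib_left mult.left_commute)
    show ?thesis
    proof (cases "j < k")
      case True
      then show ?thesis unfolding split using x y by (simp add: e_def r_def)
    next
      case False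
      then have "j = k" using that by simp
      moreover have "(\<Sum>i<m. a k i * e i) = (\<Sum>i<m. r i * e i)"
        by (rule ak) (use x in \<open>simp add: e_def\<close>)
      moreover have "(\<Sum>i<m. a k i * r i) = (\<Sum>i<m. r i * r i)"
        by (rule ak) (use y in \<open>simp add: r_def\<close>)
      ultimately show ?thesis unfolding split using re by simp
    qed
  qed
  then show ?case unfolding residual[symmetric] by blast
qed

text \<open>Column \<open>c\<close> of \<open>U\<close> solves the least squares problem whose
  right-hand side is the \<open>c\<close>-th unit vector.\<close>

lemma normal_equations_mat:
  fixes A :: "real mat"
  assumes A: "A \<in> carrier_mat m n"
  obtains U where "U \<in> carrier_mat n m" "transpose_mat A * (A * U) = transpose_mat A"
proof -
  have "\<forall>c. \<exists>x. \<forall>j<n. (\<Sum>i<m. A $$ (i,j) *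
      ((if i = c then 1 else 0) - (\<Sum>l<n. x l * A $$ (i,l)))) = 0"
    by (intro allI normal_equations_sum[where a = "\<lambda>j i. A $$ (i,j)"])
  from choice[OF this] obtain x where x: "\<And>c j. j < n \<Longrightarrow>
      (\<Sum>i<m. A $$ (i,j) * ((if i = c then 1 else 0) - (\<Sum>l<n. x c l * A $$ (i,l)))) = 0"
    by blast
  define U where "U = mat n m (\<lambda>(l,c). x c l)"
  have U: "U \<in> carrier_mat n m" by (simp add: U_def)
  have "transpose_mat A * (A * U) = transpose_mat A"
  proof (rule eq_matI)
    fix j c assume "j < dim_row (transpose_mat A)" "c < dim_col (transpose_mat A)"
    then have j: "j < n" and c: "c < m" using A by auto
    have "(transpose_mat A * (A * U)) $$ (j,c)
        = (\<Sum>i<m. A $$ (i,j) * (\<Sum>l<n. x c l * A $$ (i,l)))"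
      using A j c by (simp add: U_def scalar_prod_def atLeast0LessThan mult.commute)
    also have "\<dots> = (\<Sum>i<m. A $$ (i,j) * (if i = c then 1 else 0))"
      using x[OF j, of c] by (simp add: right_diff_distrib sum_subtractf)
    also have "\<dots> = A $$ (c,j)" using c by (simp add: if_distrib cong: if_cong)
    finally show "(transpose_mat A * (A * U)) $$ (j,c) = transpose_mat A $$ (j,c)"
      using A j c by simp
  qed (use A U in auto)
  with U that show thesis by blast
qed

text \<open>Multiplying the normal equations on the left by the transpose of \<open>U\<close> shows
  that the transpose of \<open>A * U\<close> is a Gram matrix, so \<open>A * U\<close> is symmetric.
  Transposing the normal equations then gives \<open>A * U * A = A\<close>.\<close>

lemma inverse_13_exists:
  fixes A :: "real mat"
  assumes A: "A \<in> carrier_mat m n"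
  obtains U where "U \<in> carrier_mat n m" "A * U * A = A" "transpose_mat (A * U) = A * U"
proof -
  obtain U where U: "U \<in> carrier_mat n m" and eq: "transpose_mat A * (A * U) = transpose_mat A"
    using normal_equations_mat[OF A] .
  have AU: "A * U \<in> carrier_mat m m" using A U by simp
  have At: "transpose_mat A \<in> carrier_mat n m" using A by simp
  have Ut: "transpose_mat U \<in> carrier_mat m n" using U by simp
  have "transpose_mat (A * U) = transpose_mat U * (transpose_mat A * (A * U))"
    unfolding eq using transpose_mult[OF A U] .
  also have "\<dots> = transpose_mat (A * U) * (A * U)"
    using transpose_mult[OF A U] assoc_mult_mat[OF Ut At AU] by simp
  finally have gram: "transpose_mat (A * U) = transpose_mat (A * U) * (A * U)" .
  have "transpose_mat (transpose_mat (A * U) * (A * U)) = transpose_mat (A * U) * (A * U)"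
    using transpose_mult[OF transpose_carrier_mat[THEN iffD2, OF AU] AU] by simp
  then have sym: "transpose_mat (A * U) = A * U" using gram by simp
  have "A * U * A = transpose_mat (transpose_mat A * (A * U))"
    using transpose_mult[OF At AU] sym by simp
  then have "A * U * A = A" using eq by simp
  then show thesis using U sym that by blast
qed

lemma penrose_inverse_exists: "\<exists>X. penrose_inverse A X"
proof -
  define m n where "m = dim_row A" and "n = dim_col A"
  have A: "A \<in> carrier_mat m n" by (simp add: m_def n_def)
  then have At: "transpose_mat A \<in> carrier_mat n m" by simp
  obtain U where U: "U \<in> carrier_mat n m" and U1: "A * U * A = A"
    and U3: "transpose_mat (A * U) = A * U"
    using inverse_13_exists[OF A] .
  obtain V where V: "V \<in> carrier_mat m n" and V1: "transpose_mat A * V * transpose_mat A = transpose_mat A"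
    and V3: "transpose_mat (transpose_mat A * V) = transpose_mat A * V"
    using inverse_13_exists[OF At] .
  \<comment> \<open>Transposition turns a {1,3}-inverse of the transpose of \<open>A\<close> into a
    {1,4}-inverse of \<open>A\<close>.\<close>
  define W where "W = transpose_mat V"
  have W: "W \<in> carrier_mat n m" using V by (simp add: W_def)
  have WA: "W * A = transpose_mat A * V"
    using V3 transpose_mult[OF At V] by (simp add: W_def)
  have W4: "transpose_mat (W * A) = W * A" unfolding WA by (rule V3)
  have "transpose_mat (transpose_mat A) = transpose_mat (W * A * transpose_mat A)"
    unfolding WA V1 ..
  also have "\<dots> = A * (W * A)"
    using transpose_mult[of "W * A" n n "transpose_mat A" m] W A W4 by simp
  finally have W1: "A * (W * A) = A" by simp
  \<comment> \<open>Urquhart's formula: \<open>A * X\<close> collapses to \<open>A * U\<close> and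
    \<open>X * A\<close> to \<open>W * A\<close>, so \<open>X\<close> inherits one symmetry
    condition from each factor.\<close>
  define X where "X = W * (A * U)"
  have X: "X \<in> carrier_mat n m" using W A U by (simp add: X_def)
  have AU: "A * U \<in> carrier_mat m m" and WAc: "W * A \<in> carrier_mat n n" using A U W by auto
  have "A * X = A * (W * A) * U"
    unfolding X_def using A U W WAc
    by (metis assoc_mult_mat)
  then have AX: "A * X = A * U" unfolding W1 .
  have "X * A = W * (A * U * A)"
    unfolding X_def by (rule assoc_mult_mat[OF W AU A])
  then have XA: "X * A = W * A" unfolding U1 .
  have "X * A * X = W * (A * X)" unfolding XA by (rule assoc_mult_mat[OF W A X])
  also have "\<dots> = X" unfolding AX by (simp add: X_def)
  finally have "X * A * X = X" .
  then show ?thesis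
    unfolding penrose_inverse_def
    using X AX XA U1 U3 W4 by (auto simp: m_def n_def)
qed

text \<open>\<open>A * X\<close> and \<open>A * Y\<close> are both the orthogonal projection onto
  the column space of \<open>A\<close>, and \<open>X * A\<close> and \<open>Y * A\<close> both the
  one onto its row space. Hence \<open>X = X * A * X = Y * A * Y = Y\<close>.\<close>

lemma penrose_inverse_unique:
  assumes X: "penrose_inverse A X" and Y: "penrose_inverse A Y"
  shows "X = Y"
proof -
  define m n where "m = dim_row A" and "n = dim_col A"
  have A: "A \<in> carrier_mat m n" by (simp add: m_def n_def)
  have Xc: "X \<in> carrier_mat n m" and Yc: "Y \<in> carrier_mat n m"
    using X Y by (auto simp: penrose_inverse_def m_def n_def)
  have x: "A * X * A = A" "X * A * X = X" "transpose_mat (A * X) = A * X" "transpose_mat (X * A) = X * A"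
    using X by (auto simp: penrose_inverse_def)
  have y: "A * Y * A = A" "Y * A * Y = Y" "transpose_mat (A * Y) = A * Y" "transpose_mat (Y * A) = Y * A"
    using Y by (auto simp: penrose_inverse_def)
  have c: "A * X \<in> carrier_mat m m" "A * Y \<in> carrier_mat m m" "X * A \<in> carrier_mat n n" "Y * A \<in> carrier_mat n n"
    using A Xc Yc by auto
  have "A * X = (A * Y) * (A * X)"
    using assoc_mult_mat[OF c(2) A Xc] y(1) by simp
  \<comment> \<open>Transposing swaps the two symmetric factors, after which
    \<open>A * X * A = A\<close> absorbs \<open>X\<close> instead of \<open>Y\<close>.\<close>
  then have "transpose_mat (A * X) = transpose_mat ((A * Y) * (A * X))" by simp
  then have "A * X = (A * X) * (A * Y)"
    using transpose_mult[OF c(2,1)] x(3) y(3) by simp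
  also have "\<dots> = A * Y" using assoc_mult_mat[OF c(1) A Yc] x(1) by simp
  finally have AXY: "A * X = A * Y" .
  have "X * A = X * (A * Y * A)" using y(1) by simp
  also have "\<dots> = (X * A) * (Y * A)"
    using A Xc Yc c by (metis assoc_mult_mat)
  finally have "transpose_mat (X * A) = transpose_mat ((X * A) * (Y * A))" by simp
  then have "X * A = (Y * A) * (X * A)"
    using transpose_mult[OF c(3,4)] x(4) y(4) by simp
  also have "\<dots> = Y * (A * X * A)"
    using A Xc Yc c by (metis assoc_mult_mat)
  finally have XAY: "X * A = Y * A" using x(1) by simp
  have "X = Y * A * X" using x(2) XAY by simp
  also have "\<dots> = Y * (A * Y)" using assoc_mult_mat[OF Yc A Xc] AXY by simp
  also have "\<dots> = Y" using assoc_mult_mat[OF Yc A Yc] y(2) by simp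
  finally show ?thesis .
qed

lemma pinv_eqI: "penrose_inverse A X \<Longrightarrow> pinv A = X"
  unfolding pinv_def using penrose_inverse_unique by blast

lemma penrose_inverse_pinv: "penrose_inverse A (pinv A)"
  using penrose_inverse_exists pinv_eqI by blast

section \<open>Matrices with orthonormal columns\<close>

lemma orthonormal_cols_transpose_mult:
  assumes "Q \<in> carrier_mat n d" "orthonormal_cols Q"
  shows "transpose_mat Q * Q = 1\<^sub>m d"
  using assms by (intro eq_matI) (auto simp: orthonormal_cols_def)

text \<open>A case of the reverse-order law, which fails for general products. Here the inner
  factors cancel to the identity, so one product is \<open>B * X\<close> and the other is
  \<open>X * B\<close> conjugated by \<open>Q\<close>; both are symmetric.\<close>

lemma pinv_mult_transpose_orthonormal:
  assumes Q: "Q \<in> carrier_mat n d" "orthonormal_cols Q" and B: "B \<in> carrier_mat p d"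
  shows "pinv (B * transpose_mat Q) = Q * pinv B"
proof (rule pinv_eqI)
  define X where "X = pinv B"
  have QQ: "transpose_mat Q * Q = 1\<^sub>m d"
    using Q by (rule orthonormal_cols_transpose_mult)
  have Qt: "transpose_mat Q \<in> carrier_mat d n" using Q by simp
  have X: "X \<in> carrier_mat d p" and x: "B * X * B = B" "X * B * X = X"
    "transpose_mat (B * X) = B * X" "transpose_mat (X * B) = X * B"
    using penrose_inverse_pinv[of B] B by (auto simp: penrose_inverse_def X_def)
  have BQ: "B * transpose_mat Q \<in> carrier_mat p n" and QX: "Q * X \<in> carrier_mat n p"
    and BX: "B * X \<in> carrier_mat p p" and XB: "X * B \<in> carrier_mat d d"
    using B Q Qt X by auto
  have QQX: "transpose_mat Q * (Q * X) = X"
    using assoc_mult_mat[OF Qt Q(1) X] QQ X by simp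
  have left: "(B * transpose_mat Q) * (Q * X) = B * X"
    using assoc_mult_mat[OF B Qt QX] QQX by simp
  have right: "(Q * X) * (B * transpose_mat Q) = Q * ((X * B) * transpose_mat Q)"
    using assoc_mult_mat[OF Q(1) X BQ] assoc_mult_mat[OF X B Qt] by simp
  have 1: "(B * transpose_mat Q) * (Q * X) * (B * transpose_mat Q) = B * transpose_mat Q"
    unfolding left using assoc_mult_mat[OF BX B Qt] x(1) by simp
  have "(Q * X) * (B * transpose_mat Q) * (Q * X) = Q * X * (B * X)"
    using assoc_mult_mat[OF QX BQ QX] left by simp
  also have "\<dots> = Q * X"
    using assoc_mult_mat[OF Q(1) X BX] assoc_mult_mat[OF X B X] x(2) by simp
  finally have 2: "(Q * X) * (B * transpose_mat Q) * (Q * X) = Q * X" .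
  have XBQ: "(X * B) * transpose_mat Q \<in> carrier_mat d n" using XB Qt by simp
  have "transpose_mat (Q * ((X * B) * transpose_mat Q)) = (Q * (X * B)) * transpose_mat Q"
    using transpose_mult[OF Q(1) XBQ] transpose_mult[OF XB Qt] x(4) by simp
  then have 4: "transpose_mat (Q * ((X * B) * transpose_mat Q)) = Q * ((X * B) * transpose_mat Q)"
    using assoc_mult_mat[OF Q(1) XB Qt] by simp
  show "penrose_inverse (B * transpose_mat Q) (Q * pinv B)"
    unfolding penrose_inverse_def X_def[symmetric]
    using QX Q B 1 2 4 x(3) by (auto simp: left right)
qed

text \<open>\<open>Q * transpose_mat Q\<close> is the orthogonal projection onto the range of
  \<open>Q\<close>, so it fixes every column of \<open>S\<close>.\<close>

lemma factor_through_orthonormal: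
  assumes Q: "Q \<in> carrier_mat n d" "orthonormal_cols Q" and S: "S \<in> carrier_mat n p"
    and range: "\<And>i. i < p \<Longrightarrow> \<exists>y \<in> carrier_vec d. col S i = Q *\<^sub>v y"
  shows "S = Q * (transpose_mat Q * S)"
proof (rule mat_col_eqI)
  have Qt: "transpose_mat Q \<in> carrier_mat d n" using Q by simp
  then have QtS: "transpose_mat Q * S \<in> carrier_mat d p" using S by simp
  fix i assume "i < dim_col (Q * (transpose_mat Q * S))"
  then have i: "i < p" using S by simp
  then obtain y where y: "y \<in> carrier_vec d" "col S i = Q *\<^sub>v y" using range by blast
  have "transpose_mat Q *\<^sub>v (Q *\<^sub>v y) = y"
    using assoc_mult_mat_vec[OF Qt Q(1) y(1)] orthonormal_cols_transpose_mult[OF Q] y(1) by simp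
  then show "col S i = col (Q * (transpose_mat Q * S)) i"
    using col_mult2[OF Q(1) QtS i] col_mult2[OF Qt S i] y(2) by simp
qed (use Q S in auto)

theorem theorem4:
  fixes n d p :: nat
    and f fhat :: "real vec \<Rightarrow> real"
    and x0 :: "real vec"
    and S Q :: "real mat"
  assumes "x0 \<in> carrier_vec n"
    and "S \<in> carrier_mat n p"
    and "d < n"
    and "Q \<in> carrier_mat n d"
    and "orthonormal_cols Q"
    and "{x0} \<union> {x0 + col S i | i. i < p} \<subseteq> {x0 + Q *\<^sub>v xhat | xhat. xhat \<in> carrier_vec d}"
    and "\<And>xhat. xhat \<in> carrier_vec d \<Longrightarrow> fhat xhat = f (x0 + Q *\<^sub>v xhat)"
  shows "\<exists>Shat \<in> carrier_mat d p.
           S = Q * Shat \<and> gsg f x0 S = Q *\<^sub>v gsg fhat (0\<^sub>v d) Shat"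
proof (intro bexI conjI)
  note x0 = assms(1) and S = assms(2) and Q = assms(4) and ortho = assms(5) and fhat = assms(7)
  \<comment> \<open>The only candidate: multiplying \<open>S = Q * Shat\<close> on the left by the
    transpose of \<open>Q\<close> forces this value.\<close>
  let ?R = "transpose_mat Q * S"
  show R: "?R \<in> carrier_mat d p" using S Q by simp
  \<comment> \<open>Cancelling \<open>x0\<close>, entry by entry, turns membership in the affine
    space into membership in the range of \<open>Q\<close>.\<close>
  have "\<exists>y \<in> carrier_vec d. col S i = Q *\<^sub>v y" if i: "i < p" for i
  proof -
    have "x0 + col S i \<in> {x0 + Q *\<^sub>v xhat | xhat. xhat \<in> carrier_vec d}"
      using assms(6) i by blast
    then obtain y where y: "y \<in> carrier_vec d" "x0 + col S i = x0 + Q *\<^sub>v y" by blast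
    have c: "col S i \<in> carrier_vec n" "Q *\<^sub>v y \<in> carrier_vec n" using S Q i y(1) by auto
    have "col S i = Q *\<^sub>v y"
    proof (rule eq_vecI)
      fix k assume "k < dim_vec (Q *\<^sub>v y)"
      then have k: "k < n" using Q by simp
      have "(x0 + col S i) $ k = (x0 + Q *\<^sub>v y) $ k" using y(2) by simp
      moreover have "k < dim_vec (col S i)" using S k by simp
      moreover have "k < dim_vec (Q *\<^sub>v y)" by fact
      ultimately show "col S i $ k = (Q *\<^sub>v y) $ k"
        by (simp only: index_add_vec add_left_cancel)
    qed (use S Q in auto)
    then show ?thesis using y(1) by blast
  qed
  then show SR: "S = Q * ?R" by (rule factor_through_orthonormal[OF Q ortho S])
  have colR: "col ?R i \<in> carrier_vec d" "col S i = Q *\<^sub>v col ?R i" if "i < p" for i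
    using R col_mult2[OF Q R that, folded SR] that by auto
  have "Q *\<^sub>v 0\<^sub>v d = 0\<^sub>v n" using Q by auto
  then have "fhat (0\<^sub>v d) = f x0" using fhat[of "0\<^sub>v d"] x0 by simp
  \<comment> \<open>The map from \<open>y\<close> to \<open>x0 + Q *\<^sub>v y\<close> sends the
    sample points \<open>0\<close> and \<open>col ?R i\<close> to \<open>x0\<close> and
    \<open>x0 + col S i\<close>, so the function values agree.\<close>
  then have delta: "gsg_delta f x0 S = gsg_delta fhat (0\<^sub>v d) ?R"
    unfolding gsg_delta_def using S fhat colR by (intro eq_vecI) auto
  have Rt: "transpose_mat ?R \<in> carrier_mat p d" using R by simp
  \<comment> \<open>The gradient uses the pseudoinverse of the transpose, and transposing
    \<open>S = Q * ?R\<close> puts \<open>Q\<close> on the right, as the product lemma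
    requires.\<close>
  have "pinv (transpose_mat S) = pinv (transpose_mat ?R * transpose_mat Q)"
    by (simp only: transpose_mult[OF Q R, folded SR])
  also have "\<dots> = Q * pinv (transpose_mat ?R)"
    by (rule pinv_mult_transpose_orthonormal[OF Q ortho Rt])
  finally have pinv: "pinv (transpose_mat S) = Q * pinv (transpose_mat ?R)" .
  have P: "pinv (transpose_mat ?R) \<in> carrier_mat d p"
    using penrose_inverse_pinv[of "transpose_mat ?R"] S Q unfolding penrose_inverse_def by auto
  have D: "gsg_delta fhat (0\<^sub>v d) ?R \<in> carrier_vec p"
    using S by (simp add: gsg_delta_def)
  show "gsg f x0 S = Q *\<^sub>v gsg fhat (0\<^sub>v d) ?R"
    unfolding gsg_def delta pinv by (rule assoc_mult_mat_vec[OF Q P D])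
qed

end
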